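(* Let $S_1,\dots,S_q$ be a basis of a linear subspace $\mathcal S\subseteq\mathbb{R}^{m\times n}$ such that $|A|=\sum_{i=1}^q|a_i||S_i|$ for every $A=\sum_{i=1}^qa_iS_i\in\mathcal S$. Let $A=\sum_{i=1}^qa_iS_i\in\mathcal S$ and $b\in\mathbb{R}^m$ satisfy the genericity condition $\widetilde\sigma_n>\sigma_{n+1}$, let $x$ be the unique TLS solution, and let $L\in\mathbb{R}^{k\times n}$, $k\le n$ (with $Lx\ne0$ for the mixed condition numbers). Then $$\kappa_{s,\infty}^{\mathrm{rel}}\le\kappa_\infty^{\mathrm{rel}}\qquad\text{and}\qquad\kappa_{s,c}\le\kappa_c .$$
   Context: Let $m>n$. The total least squares (TLS) problem for $A\in\mathbb{R}^{m\times n}$, $b\in\mathbb{R}^m$ is to minimize $\|[A,b]-[\widehat A,\widehat b]\|_F$ over $[\widehat A,\widehat b]\in\mathbb{R}^{m\times(n+1)}$ with $\widehat b$ in the range of $\widehat A$; any $x$ with $\widehat A x=\widehat b$ for a minimizer is a TLS solution. Let $\widetilde\sigma_n$ be the smallest singular value of $A$ and $\sigma_{n+1}$ the smallest singular value of $[A,b]$. Under the genericity condition $\widetilde\sigma_n>\sigma_{n+1}$ there is a unique TLS solution $x$; it satisfies $(A^\top A-\sigma_{n+1}^2I_n)x=A^\top b$. Put $r=b-Ax$, $P=A^\top A-\sigma_{n+1}^2I_n$, $a=[a_1,\dots,a_q]^\top$, $$\mathcal N=P^{-1}\left[-x^\top\otimes\left(A^\top+\tfrac{2xr^\top}{1+x^\top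 x}\right)+I_n\otimes r^\top\right],\qquad \mathcal H=P^{-1}\left[A^\top+\tfrac{2xr^\top}{1+x^\top x}\right],$$ $\mathcal N_s=P^{-1}V$, $V=[v_1,\dots,v_q]$, $v_i=S_i^\top r-\left[A^\top+\frac{2xr^\top}{1+x^\top x}\right]S_ix$. The unstructured mixed and componentwise condition numbers of $Lx$ are $$\kappa_\infty^{\mathrm{rel}}=\frac{\| |L\mathcal N|\mathrm{vec}(|A|)+|L\mathcal H||b| \|_\infty}{\|Lx\|_\infty},\qquad \kappa_c=\|D_{Lx}^\dagger(|L\mathcal N|\mathrm{vec}(|A|)+|L\mathcal H||b|)\|_\infty,$$ and the structured ones are $$\kappa_{s,\infty}^{\mathrm{rel}}=\frac{\| |L\mathcal N_s||a|+|L\mathcal H||b| \|_\infty}{\|Lx\|_\infty},\qquad \kappa_{s,c}=\|D_{Lx}^\dagger(|L\mathcal N_s||a|+|L\mathcal H||b|)\|_\infty .$$ $|\cdot|$ is the entrywise absolute value, $\otimes$ the Kronecker product $[a_{ij}B]$, $\mathrm{vec}$ stacks columns, $D_{Lx}$ is the diagonal matrix with diagonal $Lx$, and $\dagger$ is the Moore–Penrose inverse. *)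

theory Defs
  imports "HOL-Analysis.Analysis"
begin

text \<open>
  A real \<open>m \<times> n\<close> matrix is an element of \<open>real ^ 'n ^ 'm\<close>. On this type the library's
  \<open>norm\<close> is the Frobenius norm and the library's \<open>\<bar>_\<bar>\<close> is the entrywise absolute value;
  \<open>infnorm\<close> is the maximum norm of a vector.
\<close>

definition append_column :: "real^'n^'m \<Rightarrow> real^'m \<Rightarrow> real^('n + 1)^'m"
  where "append_column A b = (\<chi> i j. case j of Inl l \<Rightarrow> A $ i $ l | Inr _ \<Rightarrow> b $ i)"

definition outer :: "real^'n \<Rightarrow> real^'m \<Rightarrow> real^'m^'n"
  where "outer x r = (\<chi> i j. x $ i * r $ j)"

definition diag_matrix :: "real^'k \<Rightarrow> real^'k^'k"
  where "diag_matrix y = (\<chi> i j. if i = j then y $ i else 0)"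

text \<open>
  In a product index the first component is the block index, so \<open>kronecker A B\<close> is the
  block matrix \<open>[a\<^sub>i\<^sub>j B]\<close>. Accordingly, \<open>vectorize\<close> stacks columns:
  the block index is the column index of the matrix.
\<close>

definition kronecker :: "real^'n^'m \<Rightarrow> real^'q^'p \<Rightarrow> real^('n \<times> 'q)^('m \<times> 'p)"
  where "kronecker A B = (\<chi> i j. A $ fst i $ fst j * B $ snd i $ snd j)"

definition vectorize :: "real^'n^'m \<Rightarrow> real^('n \<times> 'm)"
  where "vectorize A = (\<chi> j. A $ snd j $ fst j)"

text \<open>
  The row index types \<open>1 \<times> 'n\<close> and \<open>'n \<times> 1\<close> of the products below, in which one factor
  is a single row, are identified with \<open>'n\<close> in the obvious way.
\<close>

definition kronecker_row_left :: "real^'p^1 \<Rightarrow> real^'q^'n \<Rightarrow> real^('p \<times> 'q)^'n"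
  where "kronecker_row_left u B = (\<chi> i. kronecker u B $ (1, i))"

definition kronecker_row_right :: "real^'p^'n \<Rightarrow> real^'q^1 \<Rightarrow> real^('p \<times> 'q)^'n"
  where "kronecker_row_right A v = (\<chi> i. kronecker A v $ (i, 1))"

definition is_moore_penrose :: "real^'n^'m \<Rightarrow> real^'m^'n \<Rightarrow> bool"
  where "is_moore_penrose A X \<longleftrightarrow>
    A ** X ** A = A \<and> X ** A ** X = X \<and>
    transpose (A ** X) = A ** X \<and> transpose (X ** A) = X ** A"

definition moore_penrose :: "real^'n^'m \<Rightarrow> real^'m^'n"
  where "moore_penrose A = (THE X. is_moore_penrose A X)"

text \<open>
  Singular values are the nonnegative square roots of the eigenvalues of \<open>A\<^sup>T A\<close>.
  This is the usual notion for matrices with at least as many rows as columns; it is used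
  only for such matrices.
\<close>

definition singular_value :: "real^'n^'m \<Rightarrow> real \<Rightarrow> bool"
  where "singular_value A s \<longleftrightarrow>
    s \<ge> 0 \<and> (\<exists>v. v \<noteq> 0 \<and> (transpose A ** A) *v v = s\<^sup>2 *\<^sub>R v)"

definition min_singular_value :: "real^'n^'m \<Rightarrow> real"
  where "min_singular_value A = Min {s. singular_value A s}"

definition tls_minimizer ::
  "real^'n^'m \<Rightarrow> real^'m \<Rightarrow> real^'n^'m \<Rightarrow> real^'m \<Rightarrow> bool"
  where "tls_minimizer A b A' b' \<longleftrightarrow>
    is_arg_min (\<lambda>(B, c). norm (append_column A b - append_column B c))
      (\<lambda>(B, c). c \<in> range ((*v) B)) (A', b')"

definition tls_solution :: "real^'n^'m \<Rightarrow> real^'m \<Rightarrow> real^'n \<Rightarrow> bool"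
  where "tls_solution A b x \<longleftrightarrow> (\<exists>A' b'. tls_minimizer A b A' b' \<and> A' *v x = b')"

definition tls_generic :: "real^'n^'m \<Rightarrow> real^'m \<Rightarrow> bool"
  where "tls_generic A b \<longleftrightarrow>
    min_singular_value A > min_singular_value (append_column A b)"

text \<open>
  To first order, perturbing \<open>(A, b)\<close> by \<open>(E, f)\<close> changes the solution \<open>x\<close> by
  \<open>N vec(E) + H f\<close>, with \<open>N\<close> = \<open>tls_N A b x\<close> and \<open>H\<close> = \<open>tls_H A b x\<close>. If
  \<open>E\<close> is the combination of the \<open>S i\<close> with coefficients \<open>e\<close>, the first term becomes
  \<open>N\<^sub>s e\<close> with \<open>N\<^sub>s\<close> = \<open>tls_Ns S A b x\<close>.
\<close>

definition tls_P :: "real^'n^'m \<Rightarrow> real^'m \<Rightarrow> real^'n^'n"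
  where "tls_P A b =
    transpose A ** A - (min_singular_value (append_column A b))\<^sup>2 *\<^sub>R mat 1"

definition tls_residual :: "real^'n^'m \<Rightarrow> real^'m \<Rightarrow> real^'n \<Rightarrow> real^'m"
  where "tls_residual A b x = b - A *v x"

definition tls_G :: "real^'n^'m \<Rightarrow> real^'m \<Rightarrow> real^'n \<Rightarrow> real^'m^'n"
  where "tls_G A b x =
    transpose A + (2 / (1 + x \<bullet> x)) *\<^sub>R outer x (tls_residual A b x)"

definition tls_N :: "real^'n^'m \<Rightarrow> real^'m \<Rightarrow> real^'n \<Rightarrow> real^('n \<times> 'm)^'n"
  where "tls_N A b x = matrix_inv (tls_P A b) **
    (kronecker_row_left (- rowvector x) (tls_G A b x)
     + kronecker_row_right (mat 1) (rowvector (tls_residual A b x)))"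

definition tls_H :: "real^'n^'m \<Rightarrow> real^'m \<Rightarrow> real^'n \<Rightarrow> real^'m^'n"
  where "tls_H A b x = matrix_inv (tls_P A b) ** tls_G A b x"

definition tls_V ::
  "('q \<Rightarrow> real^'n^'m) \<Rightarrow> real^'n^'m \<Rightarrow> real^'m \<Rightarrow> real^'n \<Rightarrow> real^'q^'n"
  where "tls_V S A b x = transpose
    (\<chi> i. transpose (S i) *v tls_residual A b x - tls_G A b x *v (S i *v x))"

definition tls_Ns ::
  "('q \<Rightarrow> real^'n^'m) \<Rightarrow> real^'n^'m \<Rightarrow> real^'m \<Rightarrow> real^'n \<Rightarrow> real^'q^'n"
  where "tls_Ns S A b x = matrix_inv (tls_P A b) ** tls_V S A b x"

definition sensitivity ::
  "real^'n^'k \<Rightarrow> real^'n^'m \<Rightarrow> real^'m \<Rightarrow> real^'n \<Rightarrow> real^'k"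
  where "sensitivity L A b x =
    \<bar>L ** tls_N A b x\<bar> *v vectorize \<bar>A\<bar> + \<bar>L ** tls_H A b x\<bar> *v \<bar>b\<bar>"

definition structured_sensitivity ::
  "real^'n^'k \<Rightarrow> ('q \<Rightarrow> real^'n^'m) \<Rightarrow> real^'q \<Rightarrow> real^'n^'m \<Rightarrow> real^'m \<Rightarrow> real^'n \<Rightarrow> real^'k"
  where "structured_sensitivity L S a A b x =
    \<bar>L ** tls_Ns S A b x\<bar> *v \<bar>a\<bar> + \<bar>L ** tls_H A b x\<bar> *v \<bar>b\<bar>"

definition mixed_cond ::
  "real^'n^'k \<Rightarrow> real^'n^'m \<Rightarrow> real^'m \<Rightarrow> real^'n \<Rightarrow> real"
  where "mixed_cond L A b x = infnorm (sensitivity L A b x) / infnorm (L *v x)"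

definition componentwise_cond ::
  "real^'n^'k \<Rightarrow> real^'n^'m \<Rightarrow> real^'m \<Rightarrow> real^'n \<Rightarrow> real"
  where "componentwise_cond L A b x =
    infnorm (moore_penrose (diag_matrix (L *v x)) *v sensitivity L A b x)"

definition structured_mixed_cond ::
  "real^'n^'k \<Rightarrow> ('q \<Rightarrow> real^'n^'m) \<Rightarrow> real^'q \<Rightarrow> real^'n^'m \<Rightarrow> real^'m \<Rightarrow> real^'n \<Rightarrow> real"
  where "structured_mixed_cond L S a A b x =
    infnorm (structured_sensitivity L S a A b x) / infnorm (L *v x)"

definition structured_componentwise_cond ::
  "real^'n^'k \<Rightarrow> ('q \<Rightarrow> real^'n^'m) \<Rightarrow> real^'q \<Rightarrow> real^'n^'m \<Rightarrow> real^'m \<Rightarrow> real^'n \<Rightarrow> real"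
  where "structured_componentwise_cond L S a A b x =
    infnorm (moore_penrose (diag_matrix (L *v x)) *v structured_sensitivity L S a A b x)"

end

theory Submission
  imports Defs
begin

text \<open>
  A structured perturbation of \<open>A\<close> is in particular a perturbation of \<open>A\<close>, so the structured
  derivative is the unstructured one restricted to the subspace: column \<open>i\<close> of
  \<open>N\<^sub>s\<close> is \<open>N vec(S\<^sub>i)\<close> (\<open>column_tls_Ns\<close>). By the triangle
  inequality, row by row,
  \<open>\<bar>L N\<^sub>s\<bar> \<bar>a\<bar> \<le> \<Sum>\<^sub>i \<bar>a\<^sub>i\<bar> \<bar>L N\<bar> vec(\<bar>S\<^sub>i\<bar>) = \<bar>L N\<bar> vec(\<bar>A\<bar>)\<close>,
  where the equality is the hypothesis that taking absolute values commutes with the expansion in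
  the basis. The terms containing \<open>b\<close> agree, so the structured sensitivity vector is
  entrywise at most the unstructured one.

  Both condition numbers are obtained from the sensitivity vector by a scaling that preserves
  such an inequality between nonnegative vectors: a division by the norm of \<open>L x\<close> in the mixed
  case, and in the componentwise case a multiplication by the Moore-Penrose inverse of a diagonal
  matrix, which is again diagonal (\<open>moore_penrose_diag_matrix\<close>).
\<close>

lemma infnorm_mono:
  fixes u v :: "real^'n"
  assumes "\<And>i. \<bar>u $ i\<bar> \<le> \<bar>v $ i\<bar>"
  shows "infnorm u \<le> infnorm v"
proof -
  have "\<bar>u $ i\<bar> \<le> infnorm v" for i
    by (rule order_trans[OF assms component_le_infnorm_cart])
  then show ?thesis
    unfolding infnorm_cart[of u] by (intro cSup_least) auto
qed

text \<open>
  If \<open>X\<close> and \<open>Y\<close> satisfy the Penrose equations, then \<open>A X = A Y\<close> and \<open>X A = Y A\<close>, because both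
  sides of the first equation are the orthogonal projection onto the range of \<open>A\<close>, and both sides
  of the second the orthogonal projection along its kernel. Hence
  \<open>X = X A X = Y A Y = Y\<close>.
\<close>

lemma is_moore_penrose_unique:
  assumes X: "is_moore_penrose A X" and Y: "is_moore_penrose A Y"
  shows "X = Y"
proof -
  have X1: "A ** X ** A = A" and X2: "X ** A ** X = X"
    and X3: "transpose (A ** X) = A ** X" and X4: "transpose (X ** A) = X ** A"
    using X by (auto simp: is_moore_penrose_def)
  have Y1: "A ** Y ** A = A" and Y2: "Y ** A ** Y = Y"
    and Y3: "transpose (A ** Y) = A ** Y" and Y4: "transpose (Y ** A) = Y ** A"
    using Y by (auto simp: is_moore_penrose_def)
  have "A ** X = (A ** Y) ** (A ** X)"
    by (simp only: matrix_mul_assoc Y1)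
  also have "\<dots> = transpose ((A ** X) ** (A ** Y))"
    by (subst matrix_transpose_mul) (simp only: X3 Y3)
  also have "\<dots> = A ** Y"
    by (simp only: matrix_mul_assoc X1 Y3)
  finally have AX: "A ** X = A ** Y" .
  have "X ** A = X ** (A ** Y ** A)"
    by (simp only: Y1)
  also have "\<dots> = (X ** A) ** (Y ** A)"
    by (simp only: matrix_mul_assoc)
  also have "\<dots> = transpose ((Y ** A) ** (X ** A))"
    by (subst matrix_transpose_mul) (simp only: X4 Y4)
  also have "(Y ** A) ** (X ** A) = Y ** (A ** X ** A)"
    by (simp only: matrix_mul_assoc)
  also have "transpose \<dots> = Y ** A"
    by (simp only: X1 Y4)
  finally have XA: "X ** A = Y ** A" .
  have "X = Y ** A ** X"
    by (simp only: X2 flip: XA)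
  also have "\<dots> = Y ** A ** Y"
    by (simp only: AX flip: matrix_mul_assoc)
  finally show ?thesis
    by (simp only: Y2)
qed

lemma diag_matrix_mult:
  "diag_matrix y ** diag_matrix z = diag_matrix (\<chi> i. y $ i * z $ i)"
  by (simp add: diag_matrix_def matrix_matrix_mult_def vec_eq_iff mult_delta_left)

lemma transpose_diag_matrix: "transpose (diag_matrix y) = diag_matrix y"
  by (auto simp: diag_matrix_def transpose_def vec_eq_iff)

lemma diag_matrix_mult_vec: "diag_matrix y *v u = (\<chi> i. y $ i * u $ i)"
  by (simp add: diag_matrix_def matrix_vector_mult_def vec_eq_iff mult_delta_left)

text \<open>
  A zero diagonal entry stays zero: this is where the convention \<open>inverse 0 = 0\<close> matches the
  Moore-Penrose inverse.
\<close>

lemma moore_penrose_diag_matrix: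
  "moore_penrose (diag_matrix y) = diag_matrix (\<chi> i. inverse (y $ i))"
proof -
  have scalar: "c * inverse c * c = c \<and> inverse c * c * inverse c = inverse c" for c :: real
    by (cases "c = 0") simp_all
  have inv: "is_moore_penrose (diag_matrix y) (diag_matrix (\<chi> i. inverse (y $ i)))"
    unfolding is_moore_penrose_def diag_matrix_mult transpose_diag_matrix
    by (simp only: vec_lambda_beta vec_lambda_eta scalar simp_thms)
  show ?thesis
    unfolding moore_penrose_def
  proof (rule the_equality)
    show "X = diag_matrix (\<chi> i. inverse (y $ i))" if "is_moore_penrose (diag_matrix y) X" for X
      by (rule is_moore_penrose_unique[OF that inv])
  qed (rule inv)
qed

lemma sum_UNIV_prod:
  fixes f :: "'a::finite \<times> 'b::finite \<Rightarrow> 'c::comm_monoid_add"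
  shows "(\<Sum>j\<in>UNIV. f j) = (\<Sum>p\<in>UNIV. \<Sum>q\<in>UNIV. f (p, q))"
  by (simp add: sum.cartesian_product flip: UNIV_Times_UNIV)

lemma column_matrix_matrix_mult: "column i (A ** B) = A *v column i B"
  by (simp add: column_def matrix_matrix_mult_def matrix_vector_mult_def vec_eq_iff)

text \<open>
  The next two identities are the instances of \<open>(C\<^sup>T \<otimes> A) vec(B) = vec(A B C)\<close> in which one
  outer factor is a vector.
\<close>

lemma kronecker_row_left_mult_vectorize:
  "kronecker_row_left (rowvector u) B *v vectorize E = B *v (E *v u)"
proof (subst vec_eq_iff, rule allI)
  fix i
  have "(kronecker_row_left (rowvector u) B *v vectorize E) $ i
      = (\<Sum>p\<in>UNIV. \<Sum>q\<in>UNIV. u $ p * B $ i $ q * E $ q $ p)"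
    by (simp add: kronecker_row_left_def kronecker_def vectorize_def rowvector_def
        matrix_vector_mult_def sum_UNIV_prod)
  also have "\<dots> = (\<Sum>q\<in>UNIV. \<Sum>p\<in>UNIV. u $ p * B $ i $ q * E $ q $ p)"
    by (rule sum.swap)
  also have "\<dots> = (B *v (E *v u)) $ i"
    by (simp add: matrix_vector_mult_def sum_distrib_left mult_ac)
  finally show "(kronecker_row_left (rowvector u) B *v vectorize E) $ i = (B *v (E *v u)) $ i" .
qed

lemma kronecker_row_right_mult_vectorize:
  "kronecker_row_right (mat 1) (rowvector r) *v vectorize E = transpose E *v r"
proof (subst vec_eq_iff, rule allI)
  fix i
  have "(kronecker_row_right (mat 1) (rowvector r) *v vectorize E) $ i
      = (\<Sum>p\<in>UNIV. \<Sum>q\<in>UNIV. (if i = p then 1 else 0) * r $ q * E $ q $ p)"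
    by (simp add: kronecker_row_right_def kronecker_def vectorize_def rowvector_def mat_def
        matrix_vector_mult_def sum_UNIV_prod)
  also have "\<dots> = (\<Sum>p\<in>UNIV. if i = p then \<Sum>q\<in>UNIV. r $ q * E $ q $ p else 0)"
    by (intro sum.cong) auto
  also have "\<dots> = (transpose E *v r) $ i"
    by (simp add: matrix_vector_mult_def transpose_def mult_ac)
  finally show "(kronecker_row_right (mat 1) (rowvector r) *v vectorize E) $ i
      = (transpose E *v r) $ i" .
qed

text \<open>
  Both sides stand for the first-order change of the solution when \<open>A\<close> is perturbed along
  \<open>S i\<close>: by the two identities above, \<open>v\<^sub>i\<close> is the bracket in the definition of \<open>N\<close>
  applied to \<open>vec(S\<^sub>i)\<close>.
\<close>

lemma column_tls_Ns: "column i (tls_Ns S A b x) = tls_N A b x *v vectorize (S i)"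
proof -
  have neg: "- rowvector x = rowvector (- x)"
    by (simp add: rowvector_def vec_eq_iff)
  have "column i (tls_V S A b x)
      = transpose (S i) *v tls_residual A b x - tls_G A b x *v (S i *v x)"
    by (simp add: tls_V_def column_def transpose_def vec_eq_iff)
  also have "\<dots> = (kronecker_row_left (- rowvector x) (tls_G A b x)
      + kronecker_row_right (mat 1) (rowvector (tls_residual A b x))) *v vectorize (S i)"
    by (simp add: neg matrix_vector_mult_add_rdistrib kronecker_row_left_mult_vectorize
        kronecker_row_right_mult_vectorize linear_neg[OF matrix_vector_mul_linear])
  finally show ?thesis
    by (simp add: tls_Ns_def tls_N_def matrix_vector_mul_assoc[symmetric]
        column_matrix_matrix_mult)
qed

text \<open>
  Any cancellation among the entries of a basis matrix \<open>S i\<close> is lost when absolute values are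
  taken inside the sum over these entries; no further loss occurs when the \<open>\<bar>S i\<bar>\<close> are recombined,
  because the assumption reassembles \<open>\<bar>A\<bar>\<close> exactly.
\<close>

lemma structured_sensitivity_le:
  fixes a :: "real^'q::finite"
  assumes abs_A: "\<bar>A\<bar> = (\<Sum>i\<in>UNIV. \<bar>a $ i\<bar> *\<^sub>R \<bar>S i\<bar>)"
  shows "structured_sensitivity L S a A b x $ k \<le> sensitivity L A b x $ k"
proof -
  define M where "M = L ** tls_N A b x"
  have entry: "(L ** tls_Ns S A b x) $ k $ i = (\<Sum>j\<in>UNIV. M $ k $ j * vectorize (S i) $ j)" for i
  proof -
    have "column i (L ** tls_Ns S A b x) = M *v vectorize (S i)"
      by (simp add: M_def column_matrix_matrix_mult column_tls_Ns matrix_vector_mul_assoc)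
    then show ?thesis
      by (simp add: column_def matrix_vector_mult_def vec_eq_iff)
  qed
  have vec_A: "vectorize \<bar>A\<bar> $ j = (\<Sum>i\<in>UNIV. \<bar>a $ i\<bar> * \<bar>vectorize (S i) $ j\<bar>)" for j
    by (simp add: abs_A vectorize_def) (simp add: abs_vec_def)
  have abs_M: "\<bar>M\<bar> $ k $ j = \<bar>M $ k $ j\<bar>" for j
    by (simp add: abs_vec_def)
  have "(\<bar>L ** tls_Ns S A b x\<bar> *v \<bar>a\<bar>) $ k
      = (\<Sum>i\<in>UNIV. \<bar>\<Sum>j\<in>UNIV. M $ k $ j * vectorize (S i) $ j\<bar> * \<bar>a $ i\<bar>)"
    by (simp add: matrix_vector_mult_def entry abs_vec_def)
  also have "\<dots> \<le> (\<Sum>i\<in>UNIV. (\<Sum>j\<in>UNIV. \<bar>M $ k $ j\<bar> * \<bar>vectorize (S i) $ j\<bar>) * \<bar>a $ i\<bar>)"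
    by (intro sum_mono mult_right_mono order_trans[OF sum_abs]) (simp_all add: abs_mult)
  also have "\<dots> = (\<Sum>j\<in>UNIV. \<Sum>i\<in>UNIV. \<bar>M $ k $ j\<bar> * \<bar>vectorize (S i) $ j\<bar> * \<bar>a $ i\<bar>)"
    unfolding sum_distrib_right by (rule sum.swap)
  also have "\<dots> = (\<bar>M\<bar> *v vectorize \<bar>A\<bar>) $ k"
    by (simp add: matrix_vector_mult_def abs_M vec_A sum_distrib_left mult_ac)
  finally show ?thesis
    by (simp add: structured_sensitivity_def sensitivity_def M_def)
qed

lemma structured_sensitivity_nonneg: "0 \<le> structured_sensitivity L S a A b x $ k"
  by (simp add: structured_sensitivity_def matrix_vector_mult_def abs_vec_def sum_nonneg)

theorem theorem3p5:
  fixes S :: "'q::finite \<Rightarrow> real^'n^'m"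
    and \<S> :: "(real^'n^'m) set"
    and A :: "real^'n^'m"
    and a :: "real^'q"
    and b :: "real^'m"
    and x :: "real^'n"
    and L :: "real^'n^'k"
  assumes "CARD('n) < CARD('m)"
    and "CARD('k) \<le> CARD('n)"
    and "subspace \<S>"
    and "inj S" and "independent (range S)" and "span (range S) = \<S>"
    and "\<And>c :: real^'q.
      \<bar>\<Sum>i\<in>UNIV. c $ i *\<^sub>R S i\<bar> = (\<Sum>i\<in>UNIV. \<bar>c $ i\<bar> *\<^sub>R \<bar>S i\<bar>)"
    and "A = (\<Sum>i\<in>UNIV. a $ i *\<^sub>R S i)"
    and "tls_generic A b"
    and "tls_solution A b x"
  shows "(L *v x \<noteq> 0 \<longrightarrow> structured_mixed_cond L S a A b x \<le> mixed_cond L A b x)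
    \<and> structured_componentwise_cond L S a A b x \<le> componentwise_cond L A b x"
proof -
  have "\<bar>A\<bar> = (\<Sum>i\<in>UNIV. \<bar>a $ i\<bar> *\<^sub>R \<bar>S i\<bar>)"
    using assms(7,8) by simp
  then have le: "\<bar>structured_sensitivity L S a A b x $ k\<bar> \<le> \<bar>sensitivity L A b x $ k\<bar>" for k
    using structured_sensitivity_le[of A a S L b x k]
      structured_sensitivity_nonneg[of L S a A b x k] by linarith
  have "structured_mixed_cond L S a A b x \<le> mixed_cond L A b x"
    unfolding structured_mixed_cond_def mixed_cond_def
    by (intro divide_right_mono infnorm_mono le infnorm_pos_le)
  moreover have "structured_componentwise_cond L S a A b x \<le> componentwise_cond L A b x"
    unfolding structured_componentwise_cond_def componentwise_cond_def
      moore_penrose_diag_matrix diag_matrix_mult_vec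
    by (intro infnorm_mono) (simp add: abs_mult mult_left_mono le)
  ultimately show ?thesis by blast
qed

end
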